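(* Let $P$ be a semigroup which embeds into a group $G$; regard $P\subseteq G$. The groupoid $G\ltimes\partial\Omega_P$ is purely infinite if and only if there exist $p,q\in P$ with $pP\cap qP=\emptyset$.
   Context: All semigroups and groups are discrete and countable. The left inverse hull $I_l(P)$ is the smallest semigroup of partial bijections of $P$ (product = composition on the largest possible domain) closed under inverses and containing all maps $P\to pP$, $x\mapsto px$ ($p\in P$); $I_l(P)^\times$ is the set of its elements other than the nowhere defined map. $\mathcal J_P=\{\mathrm{dom}(s):s\in I_l(P)\}$. $\widehat{\mathcal J_P}$ is the set of non-zero maps $\chi:\mathcal J_P\to\{0,1\}$ with $\chi(X\cap Y)=\chi(X)\chi(Y)$ and $\chi(\emptyset)=0$ if $\emptyset\in\mathcal J_P$, with the topology of pointwise convergence. $\partial\Omega_P$ is the closure in $\widehat{\mathcal J_P}$ of the set of $\chi$ for which $\{X:\chi(X)=1\}$ is maximal (with respect to inclusion) among all characters $\chi\in\widehat{\mathcal J_P}$. For $s\in I_l(P)^\times$, $\sigma(s)\in G$ is the unique element with $s(x)=\sigma(s)x$ on $\mathrm{dom}(s)$. $G$ acts partially on $\widehat{\mathcal J_P}$: $U_{g^{-1}}=\{\chi:\chi(\mathrm{dom}(s))=1\text{ for some }s\in I_l(P)^\times,\sigma(s)=g\}$, $(g.\chi)(X)=\chi(s^{-1}(X\cap\mathrm{im}(s)))$; $\partial\Omega_P$ is invariant, and we restrict the partial action (replacing $U_g$ by $U_g\cap\partial\Omega_P$). $G\ltimes\partial\Omega_P=\{(g,\chi):\chi\in U_{g^{-1}}\}$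 is the transformation groupoid, with source $\chi$, range $g.\chi$, product $(g_1,g_2.\chi)(g_2,\chi)=(g_1g_2,\chi)$. For a partial dynamical system $G\curvearrowright X$ with open domains $U_{g^{-1}}$, the transformation groupoid $G\ltimes X$ is purely infinite if and only if every (non-empty) compact open subset $V\subseteq X$ is $(G,\mathcal{CO})$-paradoxical (take this as the definition): there exist $n,m\ge1$, compact open subsets $V_1,\dots,V_{n+m}$ of $X$ and $t_1,\dots,t_{n+m}\in G$ such that $\bigcup_{i=1}^nV_i=V=\bigcup_{i=n+1}^{n+m}V_i$, $V_i\subseteq U_{t_i^{-1}}$, $t_i.V_i\subseteq V$ for all $i$, and $t_i.V_i\cap t_j.V_j=\emptyset$ for all $i\neq j$. *)

theory Defs
  imports "HOL-Algebra.Coset" "HOL-Analysis.Function_Topology"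
begin

section \<open>The left inverse hull\<close>

text \<open>
  A partial bijection of \<open>P\<close> is a map \<open>s :: 'a \<rightharpoonup> 'a\<close> that is injective on \<open>dom s\<close> and has
  \<open>dom s \<union> ran s \<subseteq> P\<close>; \<open>s \<circ>\<^sub>m t\<close> is the composition on the largest possible domain.
\<close>

definition left_translation :: "('a, 'b) monoid_scheme \<Rightarrow> 'a set \<Rightarrow> 'a \<Rightarrow> ('a \<rightharpoonup> 'a)" where
  "left_translation G P p = (\<lambda>x. if x \<in> P then Some (p \<otimes>\<^bsub>G\<^esub> x) else None)"

definition partial_inverse :: "('a \<rightharpoonup> 'a) \<Rightarrow> ('a \<rightharpoonup> 'a)" where
  "partial_inverse s = (\<lambda>y. if y \<in> ran s then Some (THE x. s x = Some y) else None)"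

inductive_set left_inverse_hull :: "('a, 'b) monoid_scheme \<Rightarrow> 'a set \<Rightarrow> ('a \<rightharpoonup> 'a) set"
  for G (structure) and P where
  translation: "p \<in> P \<Longrightarrow> left_translation G P p \<in> left_inverse_hull G P"
| inverse: "s \<in> left_inverse_hull G P \<Longrightarrow> partial_inverse s \<in> left_inverse_hull G P"
| composition: "s \<in> left_inverse_hull G P \<Longrightarrow> t \<in> left_inverse_hull G P \<Longrightarrow>
    s \<circ>\<^sub>m t \<in> left_inverse_hull G P"

definition left_inverse_hull_nz :: "('a, 'b) monoid_scheme \<Rightarrow> 'a set \<Rightarrow> ('a \<rightharpoonup> 'a) set" where
  "left_inverse_hull_nz G P = left_inverse_hull G P - {Map.empty}"

definition constructible_ideals :: "('a, 'b) monoid_scheme \<Rightarrow> 'a set \<Rightarrow> 'a set set" where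
  "constructible_ideals G P = dom ` left_inverse_hull G P"

definition group_part :: "('a, 'b) monoid_scheme \<Rightarrow> ('a \<rightharpoonup> 'a) \<Rightarrow> 'a" where
  "group_part G s = (THE g. g \<in> carrier G \<and> (\<forall>x\<in>dom s. s x = Some (g \<otimes>\<^bsub>G\<^esub> x)))"


section \<open>The character space and its boundary\<close>

text \<open>
  A map \<open>J \<rightarrow> {0, 1}\<close> is a function in \<open>J \<rightarrow>\<^sub>E {0, 1}\<close>, i.e. it takes the value \<^const>\<open>undefined\<close>
  outside \<open>J\<close>; these functions are the points of the product topology indexed by \<open>J\<close>.
\<close>

definition characters :: "'a set set \<Rightarrow> ('a set \<Rightarrow> nat) set" where
  "characters J = {\<chi> \<in> J \<rightarrow>\<^sub>E {0, 1}.
     (\<exists>X\<in>J. \<chi> X \<noteq> 0) \<and>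
     (\<forall>X\<in>J. \<forall>Y\<in>J. \<chi> (X \<inter> Y) = \<chi> X * \<chi> Y) \<and>
     ({} \<in> J \<longrightarrow> \<chi> {} = 0)}"

definition character_topology :: "'a set set \<Rightarrow> ('a set \<Rightarrow> nat) topology" where
  "character_topology J =
     subtopology (product_topology (\<lambda>_. discrete_topology {0, 1}) J) (characters J)"

definition maximal_characters :: "'a set set \<Rightarrow> ('a set \<Rightarrow> nat) set" where
  "maximal_characters J = {\<chi> \<in> characters J.
     \<forall>\<psi>\<in>characters J. {X \<in> J. \<chi> X = 1} \<subseteq> {X \<in> J. \<psi> X = 1} \<longrightarrow>
       {X \<in> J. \<psi> X = 1} = {X \<in> J. \<chi> X = 1}}"

definition boundary :: "('a, 'b) monoid_scheme \<Rightarrow> 'a set \<Rightarrow> ('a set \<Rightarrow> nat) set" where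
  "boundary G P = character_topology (constructible_ideals G P) closure_of
     maximal_characters (constructible_ideals G P)"

definition boundary_topology ::
    "('a, 'b) monoid_scheme \<Rightarrow> 'a set \<Rightarrow> ('a set \<Rightarrow> nat) topology" where
  "boundary_topology G P =
     subtopology (character_topology (constructible_ideals G P)) (boundary G P)"


section \<open>The partial action\<close>

text \<open>
  \<open>acts_through G P g \<chi> s\<close>: the element \<open>s\<close> witnesses that \<open>\<chi>\<close> lies in the domain
  \<open>U\<^bsub>g\<inverse>\<^esub>\<close> of \<open>g\<close>.
\<close>

definition acts_through ::
    "('a, 'b) monoid_scheme \<Rightarrow> 'a set \<Rightarrow> 'a \<Rightarrow> ('a set \<Rightarrow> nat) \<Rightarrow> ('a \<rightharpoonup> 'a) \<Rightarrow> bool" where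
  "acts_through G P g \<chi> s \<longleftrightarrow>
     s \<in> left_inverse_hull_nz G P \<and> group_part G s = g \<and> \<chi> (dom s) = 1"

definition char_domain :: "('a, 'b) monoid_scheme \<Rightarrow> 'a set \<Rightarrow> 'a \<Rightarrow> ('a set \<Rightarrow> nat) set" where
  "char_domain G P h =
     {\<chi> \<in> characters (constructible_ideals G P). \<exists>s. acts_through G P (inv\<^bsub>G\<^esub> h) \<chi> s}"

text \<open>
  The value \<open>(g.\<chi>)(X) = \<chi>(s\<inverse>(X \<inter> im s))\<close> does not depend on the witness \<open>s\<close>; see
  \<open>char_action_eq\<close> below.
\<close>

definition char_action ::
    "('a, 'b) monoid_scheme \<Rightarrow> 'a set \<Rightarrow> 'a \<Rightarrow> ('a set \<Rightarrow> nat) \<Rightarrow> ('a set \<Rightarrow> nat)" where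
  "char_action G P g \<chi> = (let s = SOME s. acts_through G P g \<chi> s in
     restrict (\<lambda>X. \<chi> {x \<in> dom s. the (s x) \<in> X \<inter> ran s}) (constructible_ideals G P))"

definition boundary_domain ::
    "('a, 'b) monoid_scheme \<Rightarrow> 'a set \<Rightarrow> 'a \<Rightarrow> ('a set \<Rightarrow> nat) set" where
  "boundary_domain G P h = char_domain G P h \<inter> boundary G P"


section \<open>Pure infiniteness of transformation groupoids\<close>

text \<open>
  A partial dynamical system of a group \<open>G\<close> on a space \<open>T\<close> is given by the domains \<open>U g\<close> and the
  partial homeomorphisms \<open>act g : U g\<inverse> \<rightarrow> U g\<close>.  Its transformation groupoid is
  \<open>{(g, x). g \<in> carrier G \<and> x \<in> U g\<inverse>}\<close>; pure infiniteness of this groupoid is defined through the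
  partial dynamical system.
\<close>

definition CO_paradoxical ::
    "('g, 'b) monoid_scheme \<Rightarrow> 'x topology \<Rightarrow> ('g \<Rightarrow> 'x set) \<Rightarrow> ('g \<Rightarrow> 'x \<Rightarrow> 'x) \<Rightarrow> 'x set \<Rightarrow> bool"
  where
  "CO_paradoxical G T U act V \<longleftrightarrow>
     (\<exists>(n::nat) (m::nat) W t. n \<ge> 1 \<and> m \<ge> 1 \<and>
        (\<forall>i\<in>{1..n+m}. openin T (W i) \<and> compactin T (W i) \<and> t i \<in> carrier G) \<and>
        (\<Union>i\<in>{1..n}. W i) = V \<and> (\<Union>i\<in>{n+1..n+m}. W i) = V \<and>
        (\<forall>i\<in>{1..n+m}. W i \<subseteq> U (inv\<^bsub>G\<^esub> (t i)) \<and> act (t i) ` W i \<subseteq> V) \<and>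
        (\<forall>i\<in>{1..n+m}. \<forall>j\<in>{1..n+m}. i \<noteq> j \<longrightarrow> act (t i) ` W i \<inter> act (t j) ` W j = {}))"

definition purely_infinite_transformation_groupoid ::
    "('g, 'b) monoid_scheme \<Rightarrow> 'x topology \<Rightarrow> ('g \<Rightarrow> 'x set) \<Rightarrow> ('g \<Rightarrow> 'x \<Rightarrow> 'x) \<Rightarrow> bool" where
  "purely_infinite_transformation_groupoid G T U act \<longleftrightarrow>
     (\<forall>V. V \<noteq> {} \<and> openin T V \<and> compactin T V \<longrightarrow> CO_paradoxical G T U act V)"


section \<open>Well-definedness\<close>

lemma left_inverse_hull_translation:
  assumes G: "group G" and P: "P \<subseteq> carrier G"
    and cl: "\<And>p q. p \<in> P \<Longrightarrow> q \<in> P \<Longrightarrow> p \<otimes>\<^bsub>G\<^esub> q \<in> P"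
    and s: "s \<in> left_inverse_hull G P"
  shows "dom s \<subseteq> P \<and> ran s \<subseteq> P \<and> (\<exists>g\<in>carrier G. \<forall>x\<in>dom s. s x = Some (g \<otimes>\<^bsub>G\<^esub> x))"
  using s
proof induction
  case (translation p)
  then show ?case
    using P cl by (auto simp: left_translation_def dom_def ran_def)
next
  case (inverse s)
  interpret group G by (rule G)
  from inverse.IH obtain g where d: "dom s \<subseteq> P" "ran s \<subseteq> P" and g: "g \<in> carrier G"
    and s: "\<And>x. x \<in> dom s \<Longrightarrow> s x = Some (g \<otimes>\<^bsub>G\<^esub> x)" by blast
  have inj: "x = x'" if "s x = Some y" "s x' = Some y" for x x' y
  proof -
    have x: "x \<in> dom s" "x' \<in> dom s" using that by auto
    have "g \<otimes>\<^bsub>G\<^esub> x = g \<otimes>\<^bsub>G\<^esub> x'" using s[OF x(1)] s[OF x(2)] that by simp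
    moreover have "x \<in> carrier G" "x' \<in> carrier G" using x d P by blast+
    ultimately show ?thesis using g by simp
  qed
  have *: "\<exists>x. partial_inverse s y = Some x \<and> s x = Some y" if "y \<in> ran s" for y
  proof -
    from that obtain x where "s x = Some y" by (auto simp: ran_def)
    moreover from this have "(THE x. s x = Some y) = x" using inj by blast
    ultimately show ?thesis using that by (auto simp: partial_inverse_def)
  qed
  have dom: "dom (partial_inverse s) = ran s"
    by (auto simp: partial_inverse_def split: if_splits)
  have ran: "ran (partial_inverse s) \<subseteq> dom s"
  proof
    fix x assume "x \<in> ran (partial_inverse s)"
    then obtain y where y: "partial_inverse s y = Some x" by (auto simp: ran_def)
    then have "y \<in> ran s" using dom by auto
    from *[OF this] y show "x \<in> dom s" by auto
  qed
  have "partial_inverse s y = Some (inv\<^bsub>G\<^esub> g \<otimes>\<^bsub>G\<^esub> y)" if "y \<in> dom (partial_inverse s)" for y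
  proof -
    from that have "y \<in> ran s" using dom by simp
    from *[OF this] obtain x where x: "partial_inverse s y = Some x" "s x = Some y" by blast
    then have xd: "x \<in> dom s" by auto
    then have "x \<in> carrier G" using d P by blast
    moreover have "y = g \<otimes>\<^bsub>G\<^esub> x" using s[OF xd] x(2) by simp
    ultimately have "inv\<^bsub>G\<^esub> g \<otimes>\<^bsub>G\<^esub> y = x" using g by (simp add: m_assoc[symmetric])
    with x show ?thesis by simp
  qed
  moreover have "inv\<^bsub>G\<^esub> g \<in> carrier G" using g by simp
  ultimately show ?case using dom ran d by blast
next
  case (composition s t)
  interpret group G by (rule G)
  from composition.IH(1) obtain g where ds: "dom s \<subseteq> P" "ran s \<subseteq> P" and g: "g \<in> carrier G"
    and s: "\<And>x. x \<in> dom s \<Longrightarrow> s x = Some (g \<otimes>\<^bsub>G\<^esub> x)" by blast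
  from composition.IH(2) obtain h where dt: "dom t \<subseteq> P" "ran t \<subseteq> P" and h: "h \<in> carrier G"
    and t: "\<And>x. x \<in> dom t \<Longrightarrow> t x = Some (h \<otimes>\<^bsub>G\<^esub> x)" by blast
  have "(s \<circ>\<^sub>m t) x = Some ((g \<otimes>\<^bsub>G\<^esub> h) \<otimes>\<^bsub>G\<^esub> x)" if x: "x \<in> dom (s \<circ>\<^sub>m t)" for x
  proof -
    from x obtain y where y: "t x = Some y" "y \<in> dom s"
      by (cases "t x") (auto simp: map_comp_def dom_def)
    then have xd: "x \<in> dom t" by auto
    then have "x \<in> carrier G" using dt P by blast
    moreover have "y = h \<otimes>\<^bsub>G\<^esub> x" using t[OF xd] y(1) by simp
    ultimately show ?thesis using s[OF y(2)] y(1) g h by (simp add: m_assoc)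
  qed
  moreover have "dom (s \<circ>\<^sub>m t) \<subseteq> dom t" "ran (s \<circ>\<^sub>m t) \<subseteq> ran s"
    by (auto simp: map_comp_def dom_def ran_def split: option.splits)
  ultimately have "dom (s \<circ>\<^sub>m t) \<subseteq> P" "ran (s \<circ>\<^sub>m t) \<subseteq> P"
    "\<forall>x\<in>dom (s \<circ>\<^sub>m t). (s \<circ>\<^sub>m t) x = Some ((g \<otimes>\<^bsub>G\<^esub> h) \<otimes>\<^bsub>G\<^esub> x)" using ds dt by blast+
  moreover have "g \<otimes>\<^bsub>G\<^esub> h \<in> carrier G" using g h by simp
  ultimately show ?case by blast
qed

lemma group_part_works:
  assumes G: "group G" and P: "P \<subseteq> carrier G"
    and cl: "\<And>p q. p \<in> P \<Longrightarrow> q \<in> P \<Longrightarrow> p \<otimes>\<^bsub>G\<^esub> q \<in> P"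
    and s: "s \<in> left_inverse_hull_nz G P"
  shows "group_part G s \<in> carrier G \<and> (\<forall>x\<in>dom s. s x = Some (group_part G s \<otimes>\<^bsub>G\<^esub> x))"
proof -
  interpret group G by (rule G)
  from s have "s \<in> left_inverse_hull G P" "s \<noteq> Map.empty" by (auto simp: left_inverse_hull_nz_def)
  moreover from this obtain x where x: "x \<in> dom s" by (metis dom_eq_empty_conv ex_in_conv)
  ultimately obtain g where g: "g \<in> carrier G" "\<forall>x\<in>dom s. s x = Some (g \<otimes>\<^bsub>G\<^esub> x)"
    and "x \<in> carrier G"
    using left_inverse_hull_translation[OF G P cl, of s] P by blast
  have "h = g" if "h \<in> carrier G" "\<forall>x\<in>dom s. s x = Some (h \<otimes>\<^bsub>G\<^esub> x)" for h
  proof -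
    have "Some (h \<otimes>\<^bsub>G\<^esub> x) = Some (g \<otimes>\<^bsub>G\<^esub> x)" using bspec[OF that(2) x] bspec[OF g(2) x] by metis
    then show ?thesis using that(1) g(1) \<open>x \<in> carrier G\<close> by simp
  qed
  then have "group_part G s = g" unfolding group_part_def using g by (intro the_equality) blast+
  with g show ?thesis by blast
qed

lemma char_action_eq:
  assumes G: "group G" and P: "P \<subseteq> carrier G"
    and cl: "\<And>p q. p \<in> P \<Longrightarrow> q \<in> P \<Longrightarrow> p \<otimes>\<^bsub>G\<^esub> q \<in> P"
    and chi: "\<chi> \<in> characters (constructible_ideals G P)"
    and s: "acts_through G P g \<chi> s" and X: "X \<in> constructible_ideals G P"
  shows "char_action G P g \<chi> X = \<chi> {x \<in> dom s. the (s x) \<in> X \<inter> ran s}"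
proof -
  define A where "A (u :: 'a \<rightharpoonup> 'a) = {x \<in> dom u. the (u x) \<in> X \<inter> ran u}" for u
  from X obtain r where r: "r \<in> left_inverse_hull G P" "X = dom r"
    by (auto simp: constructible_ideals_def)
  have A: "A u \<in> constructible_ideals G P" if "u \<in> left_inverse_hull G P" for u
  proof -
    have "A u = dom (r \<circ>\<^sub>m u)"
      unfolding A_def r(2) by (auto simp: map_comp_def dom_def ran_def split: option.splits)
    then show ?thesis
      using left_inverse_hull.composition[OF r(1) that] by (auto simp: constructible_ideals_def)
  qed
  have eq: "\<chi> (A u \<inter> dom v) = \<chi> (A u)"
    if "acts_through G P g \<chi> u" "acts_through G P g \<chi> v" for u v
  proof -
    have "u \<in> left_inverse_hull G P" "dom v \<in> constructible_ideals G P" "\<chi> (dom v) = 1"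
      using that by (auto simp: acts_through_def left_inverse_hull_nz_def constructible_ideals_def)
    then show ?thesis using A[of u] chi by (simp add: characters_def)
  qed
  define u where "u = (SOME s. acts_through G P g \<chi> s)"
  have u: "acts_through G P g \<chi> u" unfolding u_def using s by (rule someI[of "acts_through G P g \<chi>"])
  have us: "\<forall>x\<in>dom w. w x = Some (g \<otimes>\<^bsub>G\<^esub> x)" if "acts_through G P g \<chi> w" for w
    using group_part_works[OF G P cl, of w] that by (auto simp: acts_through_def)
  have A_iff: "x \<in> A w \<longleftrightarrow> x \<in> dom w \<and> g \<otimes>\<^bsub>G\<^esub> x \<in> X" if "acts_through G P g \<chi> w" for w x
  proof (cases "x \<in> dom w")
    case True
    with us[OF that] have "w x = Some (g \<otimes>\<^bsub>G\<^esub> x)" by blast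
    with True show ?thesis by (simp add: A_def ranI)
  qed (simp add: A_def)
  have "A u \<inter> dom s = A s \<inter> dom u"
    using A_iff[OF u] A_iff[OF s] by blast
  then have "\<chi> (A u) = \<chi> (A s)" using eq[OF u s] eq[OF s u] by simp
  then show ?thesis using X by (simp add: char_action_def u_def[symmetric] A_def)
qed

end

theory Submission
  imports Defs "HOL-Analysis.T1_Spaces"
begin

text \<open>
  Left multiplication by an element \<open>p\<close> of the semigroup \<open>P\<close> is defined on all of \<open>P\<close>, and every
  character takes the value \<open>1\<close> on the largest ideal \<open>P\<close>; hence \<open>p\<close> acts on the whole boundary,
  and it moves the boundary into the set of characters that take the value \<open>1\<close> on \<open>pP\<close>.

  Let \<open>p\<close>, \<open>q\<close> satisfy \<open>pP \<inter> qP = {}\<close>, and let \<open>V\<close> be a non-empty compact open subset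
  of the boundary.  The maximal characters are dense, and the sets \<open>{\<psi>. \<psi> X = 1}\<close> with
  \<open>\<chi> X = 1\<close> form a neighbourhood base at each maximal \<open>\<chi>\<close>
  (\<open>maximal_character_neighbourhood\<close>), so \<open>V\<close> contains the set of all boundary characters with value \<open>1\<close> on some non-empty constructible ideal \<open>X\<close>.  Choose \<open>x \<in> X\<close>.  As \<open>X\<close> is a
  right ideal, it contains \<open>xpP\<close> and \<open>xqP\<close>, so \<open>xp\<close> and \<open>xq\<close> both move the whole boundary into
  \<open>V\<close>; the two images are disjoint because \<open>xpP \<inter> xqP = {}\<close>.  Thus \<open>V\<close> is paradoxical with one
  piece on each side, namely \<open>V\<close> itself.  The remaining ingredient is that the boundary is
  invariant, which follows from continuity and from the fact that \<open>p\<close> preserves maximality of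
  characters (\<open>translate_maximal\<close>).

  Conversely, if any two principal right ideals meet, then no composition in the inverse hull is
  nowhere defined, so no constructible ideal is empty.  The constant character \<open>1\<close> is then the only
  maximal one, the boundary is a point (\<open>boundary_eq_singleton\<close>), and a point has no room for two
  disjoint non-empty images.
\<close>

section \<open>Characters of a semilattice of sets\<close>

lemma character_zero_or_one:
  assumes "\<chi> \<in> characters J" "X \<in> J"
  shows "\<chi> X = 0 \<or> \<chi> X = 1"
  using assms by (fastforce simp: characters_def PiE_def Pi_def)

lemma character_Int:
  assumes "\<chi> \<in> characters J" "X \<in> J" "Y \<in> J"
  shows "\<chi> (X \<inter> Y) = \<chi> X * \<chi> Y"
  using assms by (simp add: characters_def)

lemma character_mono:
  assumes "\<chi> \<in> characters J" "X \<in> J" "Y \<in> J" "X \<subseteq> Y" "\<chi> X = 1"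
  shows "\<chi> Y = 1"
  using character_Int[OF assms(1-3)] assms(4,5) by (simp add: Int_absorb2)

lemma character_ideal_nonempty:
  assumes "\<chi> \<in> characters J" "X \<in> J" "\<chi> X = 1"
  shows "X \<noteq> {}"
  using assms by (auto simp: characters_def)

lemma character_nonzero:
  assumes "\<chi> \<in> characters J"
  obtains X where "X \<in> J" "\<chi> X = 1"
proof -
  obtain X where "X \<in> J" "\<chi> X \<noteq> 0" using assms unfolding characters_def by blast
  then show thesis using that[of X] character_zero_or_one[OF assms, of X] by simp
qed

lemma character_eqI:
  assumes "\<chi> \<in> characters J" "\<psi> \<in> characters J"
    and "\<And>X. X \<in> J \<Longrightarrow> \<chi> X = 1 \<longleftrightarrow> \<psi> X = 1"
  shows "\<chi> = \<psi>"
proof (rule PiE_ext)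
  show "\<chi> \<in> J \<rightarrow>\<^sub>E {0, 1}" "\<psi> \<in> J \<rightarrow>\<^sub>E {0, 1}"
    using assms by (simp_all add: characters_def)
  show "\<chi> X = \<psi> X" if "X \<in> J" for X
    using character_zero_or_one[OF assms(1) that] character_zero_or_one[OF assms(2) that]
      assms(3)[OF that] by auto
qed

lemma filter_character:
  assumes "F \<subseteq> J" "F \<noteq> {}" "{} \<notin> F"
    and cl: "\<forall>X\<in>J. \<forall>Y\<in>J. X \<inter> Y \<in> J"
    and filter: "\<And>X Y. X \<in> J \<Longrightarrow> Y \<in> J \<Longrightarrow> X \<inter> Y \<in> F \<longleftrightarrow> X \<in> F \<and> Y \<in> F"
  shows "restrict (\<lambda>X. if X \<in> F then 1 else 0) J \<in> characters J"
  unfolding characters_def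
proof (intro CollectI conjI ballI impI)
  show "\<exists>X\<in>J. restrict (\<lambda>X. if X \<in> F then 1 else 0 :: nat) J X \<noteq> 0"
    using assms(1,2) by (auto simp: restrict_def)
  show "restrict (\<lambda>X. if X \<in> F then 1 else 0 :: nat) J \<in> J \<rightarrow>\<^sub>E {0, 1}"
    by (auto split: if_splits)
qed (use assms in \<open>auto simp: restrict_def\<close>)

lemma maximal_character_is_character:
  "\<chi> \<in> maximal_characters J \<Longrightarrow> \<chi> \<in> characters J"
  by (simp add: maximal_characters_def)

lemma maximal_character_eq:
  assumes "\<chi> \<in> maximal_characters J" "\<psi> \<in> characters J"
    and "\<And>X. X \<in> J \<Longrightarrow> \<chi> X = 1 \<Longrightarrow> \<psi> X = 1"
  shows "\<psi> = \<chi>"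
proof (rule character_eqI)
  have "{X \<in> J. \<psi> X = 1} = {X \<in> J. \<chi> X = 1}"
    using assms unfolding maximal_characters_def by blast
  then show "\<psi> X = 1 \<longleftrightarrow> \<chi> X = 1" if "X \<in> J" for X using that by blast
qed (use assms maximal_character_is_character in blast)+

text \<open>
  As for ultrafilters: if every set in the filter of \<open>\<chi>\<close> met \<open>Y\<close>, then that filter together with
  \<open>Y\<close> would generate a strictly larger proper filter.
\<close>

lemma maximal_character_zero_witness:
  assumes cl: "\<forall>X\<in>J. \<forall>Y\<in>J. X \<inter> Y \<in> J"
    and \<chi>: "\<chi> \<in> maximal_characters J" and Y: "Y \<in> J" "\<chi> Y = 0"
  obtains X where "X \<in> J" "\<chi> X = 1" "X \<inter> Y = {}"
proof (rule ccontr)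
  assume "\<not> thesis"
  with that have meets: "\<And>X. X \<in> J \<Longrightarrow> \<chi> X = 1 \<Longrightarrow> X \<inter> Y \<noteq> {}" by blast
  note \<chi>' = maximal_character_is_character[OF \<chi>]
  define F where "F = {Z \<in> J. \<exists>X\<in>J. \<chi> X = 1 \<and> X \<inter> Y \<subseteq> Z}"
  define \<psi> where "\<psi> = restrict (\<lambda>X. if X \<in> F then 1 else 0 :: nat) J"
  have "Y \<in> F"
    using character_nonzero[OF \<chi>'] Y unfolding F_def by blast
  have "\<psi> \<in> characters J" unfolding \<psi>_def
  proof (rule filter_character)
    show "{} \<notin> F" using meets by (auto simp: F_def)
    show "Z \<inter> Z' \<in> F \<longleftrightarrow> Z \<in> F \<and> Z' \<in> F" if Z: "Z \<in> J" "Z' \<in> J" for Z Z'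
    proof
      assume "Z \<inter> Z' \<in> F"
      then show "Z \<in> F \<and> Z' \<in> F" using Z by (auto simp: F_def)
    next
      assume "Z \<in> F \<and> Z' \<in> F"
      then obtain X X' where "X \<in> J" "\<chi> X = 1" "X \<inter> Y \<subseteq> Z" "X' \<in> J" "\<chi> X' = 1" "X' \<inter> Y \<subseteq> Z'"
        unfolding F_def by blast
      moreover from this have "\<chi> (X \<inter> X') = 1" using character_Int[OF \<chi>'] by simp
      ultimately have "X \<inter> X' \<in> J" "\<chi> (X \<inter> X') = 1" "(X \<inter> X') \<inter> Y \<subseteq> Z \<inter> Z'"
        using cl by blast+
      then show "Z \<inter> Z' \<in> F" using cl[rule_format, OF Z] unfolding F_def by blast
    qed
  qed (use \<open>Y \<in> F\<close> cl F_def in auto)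
  moreover have "\<psi> X = 1" if "X \<in> J" "\<chi> X = 1" for X
    using that by (auto simp: \<psi>_def F_def)
  ultimately have "\<psi> = \<chi>" by (rule maximal_character_eq[OF \<chi>])
  moreover have "\<psi> Y = 1" using \<open>Y \<in> F\<close> Y by (simp add: \<psi>_def)
  ultimately show False using Y by simp
qed

text \<open>
  A basic neighbourhood prescribes finitely many values, some of them \<open>0\<close>.  At a maximal character
  a value \<open>0\<close> on \<open>Y\<close> is enforced by the value \<open>1\<close> on some set disjoint from \<open>Y\<close>, so one condition
  \<open>\<psi> X = 1\<close> suffices.
\<close>

lemma maximal_character_finite_determination:
  assumes cl: "\<forall>X\<in>J. \<forall>Y\<in>J. X \<inter> Y \<in> J"
    and \<chi>: "\<chi> \<in> maximal_characters J" and "finite F" "F \<subseteq> J"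
  shows "\<exists>X\<in>J. \<chi> X = 1 \<and> (\<forall>\<psi>\<in>characters J. \<psi> X = 1 \<longrightarrow> (\<forall>Y\<in>F. \<psi> Y = \<chi> Y))"
  using assms(3,4)
proof (induction F)
  case empty
  then show ?case
    using character_nonzero[OF maximal_character_is_character[OF \<chi>]] by blast
next
  case (insert Y F)
  note \<chi>' = maximal_character_is_character[OF \<chi>]
  from insert obtain X where X: "X \<in> J" "\<chi> X = 1"
    and F: "\<And>\<psi>. \<psi> \<in> characters J \<Longrightarrow> \<psi> X = 1 \<Longrightarrow> (\<forall>Y\<in>F. \<psi> Y = \<chi> Y)" by auto
  have Y: "Y \<in> J" using insert by simp
  obtain Z where Z: "Z \<in> J" "\<chi> Z = 1"
    and ZY: "\<And>\<psi>. \<psi> \<in> characters J \<Longrightarrow> \<psi> Z = 1 \<Longrightarrow> \<psi> Y = \<chi> Y"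
  proof (cases "\<chi> Y = 1")
    case True
    then show ?thesis using that[OF Y] by simp
  next
    case False
    then have "\<chi> Y = 0" using character_zero_or_one[OF \<chi>' Y] by simp
    then obtain Z where Z: "Z \<in> J" "\<chi> Z = 1" "Z \<inter> Y = {}"
      using maximal_character_zero_witness[OF cl \<chi> Y] by blast
    have "{} \<in> J" using cl[rule_format, OF Z(1) Y] Z(3) by simp
    then have "\<psi> Y = 0" if "\<psi> \<in> characters J" "\<psi> Z = 1" for \<psi>
      using character_Int[OF that(1) Z(1) Y] Z(3) that by (auto simp: characters_def)
    with that[OF Z(1,2)] \<open>\<chi> Y = 0\<close> show ?thesis by simp
  qed
  have XZ: "X \<inter> Z \<in> J" using cl X Z by blast
  have "\<chi> (X \<inter> Z) = 1" using character_Int[OF \<chi>' X(1) Z(1)] X Z by simp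
  moreover have "\<forall>Y'\<in>insert Y F. \<psi> Y' = \<chi> Y'" if \<psi>: "\<psi> \<in> characters J" "\<psi> (X \<inter> Z) = 1" for \<psi>
  proof -
    have "\<psi> X = 1" by (rule character_mono[OF \<psi>(1) XZ X(1) _ \<psi>(2)]) simp
    moreover have "\<psi> Z = 1" by (rule character_mono[OF \<psi>(1) XZ Z(1) _ \<psi>(2)]) simp
    ultimately show ?thesis using F[OF \<psi>(1)] ZY[OF \<psi>(1)] by simp
  qed
  ultimately show ?case using XZ by blast
qed

lemma topspace_character_topology: "topspace (character_topology J) = characters J"
  by (auto simp: character_topology_def characters_def)

lemma maximal_character_neighbourhood:
  assumes cl: "\<forall>X\<in>J. \<forall>Y\<in>J. X \<inter> Y \<in> J"
    and \<chi>: "\<chi> \<in> maximal_characters J"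
    and S: "openin (character_topology J) S" "\<chi> \<in> S"
  obtains X where "X \<in> J" "\<chi> X = 1" "\<And>\<psi>. \<psi> \<in> characters J \<Longrightarrow> \<psi> X = 1 \<Longrightarrow> \<psi> \<in> S"
proof -
  from S(1) obtain T where T: "openin (product_topology (\<lambda>_. discrete_topology {0, 1}) J) T"
    and S_eq: "S = T \<inter> characters J"
    by (auto simp: character_topology_def openin_subtopology)
  from S(2) have "\<chi> \<in> T" by (simp add: S_eq)
  then obtain U where U: "finite {Y \<in> J. U Y \<noteq> {0, 1}}" "\<chi> \<in> Pi\<^sub>E J U" "Pi\<^sub>E J U \<subseteq> T"
    using T unfolding openin_product_topology_alt by auto
  let ?F = "{Y \<in> J. U Y \<noteq> {0, 1}}"
  obtain X where X: "X \<in> J" "\<chi> X = 1"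
    and F: "\<And>\<psi>. \<psi> \<in> characters J \<Longrightarrow> \<psi> X = 1 \<Longrightarrow> \<forall>Y\<in>?F. \<psi> Y = \<chi> Y"
    using maximal_character_finite_determination[OF cl \<chi> U(1)] by auto
  have "\<psi> \<in> S" if \<psi>: "\<psi> \<in> characters J" "\<psi> X = 1" for \<psi>
  proof -
    have "\<psi> \<in> Pi\<^sub>E J U"
    proof (rule PiE_I)
      show "\<psi> Y \<in> U Y" if "Y \<in> J" for Y
      proof (cases "U Y = {0, 1}")
        case True
        then show ?thesis using character_zero_or_one[OF \<psi>(1) that] by auto
      next
        case False
        then have "\<psi> Y = \<chi> Y" using F[OF \<psi>] that by blast
        then show ?thesis using U(2) that by auto
      qed
      show "\<psi> Y = undefined" if "Y \<notin> J" for Y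
        using \<psi>(1) that by (auto simp: characters_def)
    qed
    then show ?thesis using U(3) \<psi>(1) S_eq by blast
  qed
  with X that show ?thesis by blast
qed

lemma constant_one_character:
  assumes "J \<noteq> {}" "{} \<notin> J" "\<forall>X\<in>J. \<forall>Y\<in>J. X \<inter> Y \<in> J"
  shows "restrict (\<lambda>_. 1) J \<in> characters J"
  using assms by (auto simp: characters_def restrict_def)

lemma maximal_characters_eq_singleton:
  assumes "J \<noteq> {}" "{} \<notin> J" "\<forall>X\<in>J. \<forall>Y\<in>J. X \<inter> Y \<in> J"
  shows "maximal_characters J = {restrict (\<lambda>_. 1) J}"
proof -
  note one = constant_one_character[OF assms]
  have "restrict (\<lambda>_. 1) J \<in> maximal_characters J"
    unfolding maximal_characters_def using one by auto
  moreover have "\<chi> = restrict (\<lambda>_. 1) J" if "\<chi> \<in> maximal_characters J" for \<chi>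
    using maximal_character_eq[OF that one] by simp
  ultimately show ?thesis by blast
qed

lemma Hausdorff_character_topology: "Hausdorff_space (character_topology J)"
  unfolding character_topology_def
  by (intro Hausdorff_space_subtopology)
     (simp add: Hausdorff_space_product_topology Hausdorff_space_discrete_topology)


section \<open>Constructible ideals\<close>

locale group_subsemigroup = group G for G (structure) +
  fixes P :: "'a set"
  assumes P_subset: "P \<subseteq> carrier G" and P_nonempty: "P \<noteq> {}"
    and P_closed: "\<And>p q. p \<in> P \<Longrightarrow> q \<in> P \<Longrightarrow> p \<otimes> q \<in> P"
begin

abbreviation "J \<equiv> constructible_ideals G P"

lemma hull_dom_subset: "s \<in> left_inverse_hull G P \<Longrightarrow> dom s \<subseteq> P"
  using left_inverse_hull_translation[OF is_group P_subset P_closed] by blast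

lemma hull_injective:
  assumes "s \<in> left_inverse_hull G P" "s x = Some y" "s x' = Some y"
  shows "x = x'"
proof -
  obtain g where g: "g \<in> carrier G" "\<And>z. z \<in> dom s \<Longrightarrow> s z = Some (g \<otimes> z)"
    using left_inverse_hull_translation[OF is_group P_subset P_closed assms(1)] by blast
  have x: "x \<in> dom s" "x' \<in> dom s" using assms by auto
  then have "x \<in> carrier G" "x' \<in> carrier G" using hull_dom_subset[OF assms(1)] P_subset by blast+
  moreover have "g \<otimes> x = g \<otimes> x'" using g(2)[OF x(1)] g(2)[OF x(2)] assms by simp
  ultimately show ?thesis using g(1) by simp
qed

lemma partial_inverse_Some:
  assumes "s \<in> left_inverse_hull G P"
  shows "partial_inverse s y = Some x \<longleftrightarrow> s x = Some y"
proof
  have the: "(THE z. s z = Some y) = z" if "s z = Some y" for z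
    using that hull_injective[OF assms] by blast
  show "s x = Some y" if "partial_inverse s y = Some x"
    using that the by (auto simp: partial_inverse_def ran_def split: if_splits)
  show "partial_inverse s y = Some x" if "s x = Some y"
    using that the by (auto simp: partial_inverse_def ran_def)
qed

lemma dom_partial_inverse: "dom (partial_inverse s) = ran s"
  by (auto simp: partial_inverse_def split: if_splits)

lemma in_J: "s \<in> left_inverse_hull G P \<Longrightarrow> dom s \<in> J"
  by (simp add: constructible_ideals_def)

lemma dom_left_translation: "dom (left_translation G P p) = P"
  by (auto simp: left_translation_def split: if_splits)

lemma ran_left_translation: "ran (left_translation G P p) = p <# P"
  by (auto simp: left_translation_def ran_def l_coset_def)

lemma P_in_J: "P \<in> J"
proof -
  obtain p where "p \<in> P" using P_nonempty by blast
  from in_J[OF left_inverse_hull.translation[OF this]] show ?thesis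
    by (simp add: dom_left_translation)
qed

lemma J_subset_P: "X \<in> J \<Longrightarrow> X \<subseteq> P"
  using hull_dom_subset by (auto simp: constructible_ideals_def)

lemma principal_in_J: "p \<in> P \<Longrightarrow> p <# P \<in> J"
  using in_J[OF left_inverse_hull.inverse[OF left_inverse_hull.translation]]
  by (simp add: dom_partial_inverse ran_left_translation)

lemma preimage_in_J:
  assumes "X \<in> J" "p \<in> P"
  shows "{y \<in> P. p \<otimes> y \<in> X} \<in> J"
proof -
  obtain s where s: "s \<in> left_inverse_hull G P" "X = dom s"
    using assms by (auto simp: constructible_ideals_def)
  have "{y \<in> P. p \<otimes> y \<in> X} = dom (s \<circ>\<^sub>m left_translation G P p)"
    by (auto simp: s left_translation_def map_comp_def dom_def)
  then show ?thesis
    using in_J[OF left_inverse_hull.composition[OF s(1) left_inverse_hull.translation[OF assms(2)]]]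
    by simp
qed

lemma translate_in_J:
  assumes "X \<in> J" "p \<in> P"
  shows "p <# X \<in> J"
proof -
  obtain s where s: "s \<in> left_inverse_hull G P" "X = dom s"
    using assms by (auto simp: constructible_ideals_def)
  let ?t = "partial_inverse (left_translation G P p)"
  have t: "?t y = Some x \<longleftrightarrow> x \<in> P \<and> y = p \<otimes> x" for x y
    using partial_inverse_Some[OF left_inverse_hull.translation[OF assms(2)]]
    by (auto simp: left_translation_def)
  have "y \<in> dom (s \<circ>\<^sub>m ?t) \<longleftrightarrow> (\<exists>x\<in>dom s. ?t y = Some x)" for y
    by (auto simp: map_comp_def dom_def split: option.splits)
  then have "p <# X = dom (s \<circ>\<^sub>m ?t)"
    using J_subset_P[OF assms(1)] unfolding t s(2)[symmetric] l_coset_def by blast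
  then show ?thesis
    using in_J[OF left_inverse_hull.composition[OF s(1)
      left_inverse_hull.inverse[OF left_inverse_hull.translation[OF assms(2)]]]] by simp
qed

lemma J_Int:
  assumes "X \<in> J" "Y \<in> J"
  shows "X \<inter> Y \<in> J"
proof -
  obtain s t where st: "s \<in> left_inverse_hull G P" "X = dom s"
      "t \<in> left_inverse_hull G P" "Y = dom t"
    using assms by (auto simp: constructible_ideals_def)
  \<comment> \<open>the idempotent with domain \<open>Y\<close>\<close>
  let ?e = "partial_inverse t \<circ>\<^sub>m t"
  have e: "?e x = (if x \<in> dom t then Some x else None)" for x
    using partial_inverse_Some[OF st(3)] by (auto simp: map_comp_def split: option.splits)
  have "x \<in> dom (s \<circ>\<^sub>m ?e) \<longleftrightarrow> x \<in> dom s \<inter> dom t" for x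
    using e[of x] by (auto simp: map_comp_def[of s] dom_def split: if_splits)
  then have "X \<inter> Y = dom (s \<circ>\<^sub>m ?e)" unfolding st by blast
  then show ?thesis
    using in_J[OF left_inverse_hull.composition[OF st(1)
      left_inverse_hull.composition[OF left_inverse_hull.inverse[OF st(3)] st(3)]]] by simp
qed

lemma Int_closed_J: "\<forall>X\<in>J. \<forall>Y\<in>J. X \<inter> Y \<in> J"
  using J_Int by blast

text \<open>
  Elements of the hull act from the left, so they commute with right multiplication by \<open>P\<close>; this
  is what makes constructible ideals right ideals.
\<close>

lemma hull_right_equivariant:
  assumes "s \<in> left_inverse_hull G P"
  shows "s x = Some y \<Longrightarrow> p \<in> P \<Longrightarrow> s (x \<otimes> p) = Some (y \<otimes> p)"
  using assms
proof (induction arbitrary: x y)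
  case (translation q)
  then show ?case
    using P_subset P_closed by (auto simp: left_translation_def m_assoc subset_iff split: if_splits)
next
  case (inverse s)
  then show ?case by (simp add: partial_inverse_Some)
next
  case (composition s t)
  from composition.prems(1) obtain z where "t x = Some z" "s z = Some y"
    by (auto simp: map_comp_Some_iff)
  then show ?case
    using composition.IH composition.prems(2) by (auto simp: map_comp_Some_iff)
qed

lemma J_right_ideal:
  assumes "X \<in> J" "x \<in> X" "p \<in> P"
  shows "x \<otimes> p \<in> X"
  using assms hull_right_equivariant by (fastforce simp: constructible_ideals_def)

lemma hull_ran_right_ideal:
  assumes "s \<in> left_inverse_hull G P" "y \<in> ran s" "p \<in> P"
  shows "y \<otimes> p \<in> ran s"
  using J_right_ideal[OF in_J[OF left_inverse_hull.inverse[OF assms(1)]]] assms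
  by (simp add: dom_partial_inverse)

text \<open>
  Emptiness can only arise in a composition, when the range of one factor misses the domain of the
  other; these two sets are right ideals, so each contains a principal right ideal.
\<close>

lemma empty_notin_J:
  assumes meet: "\<And>p q. p \<in> P \<Longrightarrow> q \<in> P \<Longrightarrow> (p <# P) \<inter> (q <# P) \<noteq> {}"
  shows "{} \<notin> J"
proof -
  have "dom s \<noteq> {}" if "s \<in> left_inverse_hull G P" for s
    using that
  proof induction
    case (translation p)
    then show ?case using P_nonempty by (simp only: dom_left_translation not_False_eq_True)
  next
    case (inverse s)
    then show ?case unfolding dom_partial_inverse by (auto simp: ran_def dom_def)
  next
    case (composition s t)
    then obtain x y where x: "x \<in> dom s" and y: "y \<in> ran t" by (fastforce simp: ran_def dom_def)
    have "x \<in> P" using hull_dom_subset[OF composition.hyps(1)] x by blast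
    have "y \<in> P"
      using hull_dom_subset[OF left_inverse_hull.inverse[OF composition.hyps(2)]] y
      by (auto simp: dom_partial_inverse)
    from meet[OF \<open>x \<in> P\<close> \<open>y \<in> P\<close>] obtain a b where "a \<in> P" "b \<in> P" "x \<otimes> a = y \<otimes> b"
      by (auto simp: l_coset_def)
    then have "y \<otimes> b \<in> dom s" "y \<otimes> b \<in> ran t"
      using J_right_ideal[OF in_J[OF composition.hyps(1)] x]
        hull_ran_right_ideal[OF composition.hyps(2) y] by metis+
    then show ?case by (auto simp: ran_def dom_def map_comp_def split: option.splits)
  qed
  then show ?thesis by (auto simp: constructible_ideals_def)
qed

lemma boundary_eq_singleton:
  assumes "{} \<notin> J"
  shows "boundary G P = {restrict (\<lambda>_. 1) J}"
proof -
  have J: "J \<noteq> {}" using P_in_J by blast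
  have "closedin (character_topology J) {restrict (\<lambda>_. 1) J}"
    using constant_one_character[OF J assms Int_closed_J]
    by (intro closedin_Hausdorff_singleton Hausdorff_character_topology)
       (simp add: topspace_character_topology)
  then show ?thesis
    unfolding boundary_def maximal_characters_eq_singleton[OF J assms Int_closed_J]
    by (rule closure_of_closedin)
qed


section \<open>Elements of the semigroup act on the whole boundary\<close>

lemma boundary_is_character: "\<chi> \<in> boundary G P \<Longrightarrow> \<chi> \<in> characters J"
  unfolding boundary_def using closure_of_subset_topspace[of "character_topology J"]
  by (auto simp: topspace_character_topology)

lemma character_P:
  assumes "\<chi> \<in> characters J"
  shows "\<chi> P = 1"
  using character_nonzero[OF assms] character_mono[OF assms] P_in_J J_subset_P by metis

lemma acts_through_left_translation:
  assumes "\<chi> \<in> characters J" "p \<in> P"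
  shows "acts_through G P p \<chi> (left_translation G P p)"
proof -
  let ?s = "left_translation G P p"
  obtain x where x: "x \<in> P" using P_nonempty by blast
  have nz: "?s \<in> left_inverse_hull_nz G P"
    using left_inverse_hull.translation[OF assms(2)] dom_left_translation[of p] P_nonempty
    by (auto simp: left_inverse_hull_nz_def)
  have "group_part G ?s \<in> carrier G" "\<forall>x\<in>P. ?s x = Some (group_part G ?s \<otimes> x)"
    using group_part_works[OF is_group P_subset P_closed nz] by (simp_all add: dom_left_translation)
  then have "group_part G ?s \<otimes> x = p \<otimes> x" using x by (auto simp: left_translation_def)
  then have "group_part G ?s = p"
    using \<open>group_part G ?s \<in> carrier G\<close> x assms(2) P_subset by (simp add: subset_iff)
  then show ?thesis
    using nz character_P[OF assms(1)] by (simp add: acts_through_def dom_left_translation)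
qed

lemma char_action_semigroup:
  assumes "\<chi> \<in> characters J" "p \<in> P"
  shows "char_action G P p \<chi> = restrict (\<lambda>X. \<chi> {y \<in> P. p \<otimes> y \<in> X}) J"
proof
  fix X
  show "char_action G P p \<chi> X = restrict (\<lambda>X. \<chi> {y \<in> P. p \<otimes> y \<in> X}) J X"
  proof (cases "X \<in> J")
    case True
    have "{x \<in> dom (left_translation G P p).
        the (left_translation G P p x) \<in> X \<inter> ran (left_translation G P p)} = {y \<in> P. p \<otimes> y \<in> X}"
      unfolding dom_left_translation ran_left_translation
      by (auto simp: l_coset_def left_translation_def)
    then show ?thesis
      using True char_action_eq[OF is_group P_subset P_closed assms(1)
        acts_through_left_translation[OF assms] True] by simp
  qed (simp add: char_action_def Let_def)
qed

lemma char_action_apply: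
  assumes "\<chi> \<in> characters J" "p \<in> P" "X \<in> J"
  shows "char_action G P p \<chi> X = \<chi> {y \<in> P. p \<otimes> y \<in> X}"
  using char_action_semigroup[OF assms(1,2)] assms(3) by simp

lemma char_action_contains_principal:
  assumes "\<chi> \<in> characters J" "p \<in> P" "X \<in> J" "p <# P \<subseteq> X"
  shows "char_action G P p \<chi> X = 1"
proof -
  have "{y \<in> P. p \<otimes> y \<in> X} = P" using assms(4) by (auto simp: l_coset_def)
  then show ?thesis using char_action_apply[OF assms(1-3)] character_P[OF assms(1)] by simp
qed

lemma char_action_character:
  assumes \<chi>: "\<chi> \<in> characters J" and p: "p \<in> P"
  shows "char_action G P p \<chi> \<in> characters J"
  unfolding characters_def
proof (intro CollectI conjI ballI impI)
  show "char_action G P p \<chi> \<in> J \<rightarrow>\<^sub>E {0, 1}"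
    unfolding char_action_semigroup[OF assms]
    using character_zero_or_one[OF \<chi> preimage_in_J[OF _ p]] by (fastforce simp: PiE_iff)
  show "\<exists>X\<in>J. char_action G P p \<chi> X \<noteq> 0"
    using char_action_contains_principal[OF assms principal_in_J[OF p]] principal_in_J[OF p]
    by (intro bexI[of _ "p <# P"]) auto
next
  fix X Y assume XY: "X \<in> J" "Y \<in> J"
  have "{y \<in> P. p \<otimes> y \<in> X \<inter> Y} = {y \<in> P. p \<otimes> y \<in> X} \<inter> {y \<in> P. p \<otimes> y \<in> Y}" by blast
  then show "char_action G P p \<chi> (X \<inter> Y) = char_action G P p \<chi> X * char_action G P p \<chi> Y"
    using character_Int[OF \<chi> preimage_in_J[OF XY(1) p] preimage_in_J[OF XY(2) p]]
    by (simp add: char_action_apply[OF assms] XY J_Int)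
next
  assume "{} \<in> J"
  then show "char_action G P p \<chi> {} = 0"
    using \<chi> by (simp add: char_action_apply[OF assms] characters_def)
qed

lemma translate_Int:
  assumes "p \<in> P" "X \<subseteq> P" "Y \<subseteq> P"
  shows "p <# (X \<inter> Y) = (p <# X) \<inter> (p <# Y)"
proof -
  have "inj_on (\<lambda>y. p \<otimes> y) P"
    using assms(1) P_subset by (auto simp: inj_on_def subset_iff)
  moreover have "p <# Z = (\<lambda>y. p \<otimes> y) ` Z" for Z by (auto simp: l_coset_def)
  ultimately show ?thesis using inj_on_image_Int[of _ P X Y] assms by simp
qed

text \<open>
  A character \<open>\<psi>\<close> above \<open>p.\<chi>\<close> takes the value \<open>1\<close> on \<open>pP\<close>, so it can be moved back to the
  character \<open>Y \<mapsto> \<psi>(pY)\<close>, which lies above \<open>\<chi>\<close> and hence equals \<open>\<chi>\<close>.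
\<close>

lemma translate_maximal:
  assumes \<chi>: "\<chi> \<in> maximal_characters J" and p: "p \<in> P"
  shows "char_action G P p \<chi> \<in> maximal_characters J"
proof -
  note \<chi>' = maximal_character_is_character[OF \<chi>]
  have "\<psi> = char_action G P p \<chi>"
    if \<psi>: "\<psi> \<in> characters J" and le: "\<And>X. X \<in> J \<Longrightarrow> char_action G P p \<chi> X = 1 \<Longrightarrow> \<psi> X = 1" for \<psi>
  proof -
    define \<phi> where "\<phi> = restrict (\<lambda>Y. \<psi> (p <# Y)) J"
    have \<psi>p: "\<psi> (p <# P) = 1"
      using le[OF principal_in_J[OF p]] char_action_contains_principal[OF \<chi>' p principal_in_J[OF p]]
      by simp
    have \<phi>: "\<phi> \<in> characters J" unfolding characters_def
    proof (intro CollectI conjI ballI impI)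
      show "\<phi> \<in> J \<rightarrow>\<^sub>E {0, 1}"
        using character_zero_or_one[OF \<psi> translate_in_J[OF _ p]] by (fastforce simp: PiE_iff \<phi>_def)
      show "\<exists>X\<in>J. \<phi> X \<noteq> 0"
        using P_in_J \<psi>p by (intro bexI[of _ P]) (simp_all add: \<phi>_def)
      show "\<phi> (X \<inter> Y) = \<phi> X * \<phi> Y" if "X \<in> J" "Y \<in> J" for X Y
        using character_Int[OF \<psi> translate_in_J[OF that(1) p] translate_in_J[OF that(2) p]] that
        by (simp add: \<phi>_def J_Int translate_Int[OF p J_subset_P J_subset_P])
      show "\<phi> {} = 0" if "{} \<in> J"
        using \<psi> that by (simp add: \<phi>_def l_coset_def characters_def)
    qed
    have "\<phi> Y = 1" if Y: "Y \<in> J" "\<chi> Y = 1" for Y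
    proof -
      have "char_action G P p \<chi> (p <# Y) = 1"
      proof -
        have "Y \<subseteq> {y \<in> P. p \<otimes> y \<in> p <# Y}" using J_subset_P[OF Y(1)] by (auto simp: l_coset_def)
        then show ?thesis
          unfolding char_action_apply[OF \<chi>' p translate_in_J[OF Y(1) p]]
          by (rule character_mono[OF \<chi>' Y(1) preimage_in_J[OF translate_in_J[OF Y(1) p] p] _ Y(2)])
      qed
      then show ?thesis using le[OF translate_in_J[OF Y(1) p]] Y by (simp add: \<phi>_def)
    qed
    with \<phi> have \<phi>_eq: "\<phi> = \<chi>" by (rule maximal_character_eq[OF \<chi>])
    show ?thesis
    proof (rule character_eqI[OF \<psi> char_action_character[OF \<chi>' p]])
      fix X assume X: "X \<in> J"
      have "X \<inter> (p <# P) = p <# {y \<in> P. p \<otimes> y \<in> X}" by (auto simp: l_coset_def)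
      then have "\<psi> X = \<psi> (p <# {y \<in> P. p \<otimes> y \<in> X})"
        using character_Int[OF \<psi> X principal_in_J[OF p]] \<psi>p by simp
      also have "\<dots> = \<phi> {y \<in> P. p \<otimes> y \<in> X}"
        using preimage_in_J[OF X p] by (simp add: \<phi>_def)
      also have "\<dots> = char_action G P p \<chi> X"
        by (simp add: \<phi>_eq char_action_apply[OF \<chi>' p X])
      finally show "\<psi> X = 1 \<longleftrightarrow> char_action G P p \<chi> X = 1" by simp
    qed
  qed
  then show ?thesis
    unfolding maximal_characters_def using char_action_character[OF \<chi>' p] by blast
qed

lemma char_action_continuous:
  assumes p: "p \<in> P"
  shows "continuous_map (character_topology J) (character_topology J) (char_action G P p)"
proof -
  let ?D = "discrete_topology {0, 1 :: nat}"
  have coord: "continuous_map (character_topology J) ?D (\<lambda>\<chi>. \<chi> X)" if "X \<in> J" for X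
    unfolding character_topology_def
    by (intro continuous_map_from_subtopology continuous_map_product_projection[OF that])
  have "continuous_map (character_topology J) (product_topology (\<lambda>_. ?D) J) (char_action G P p)"
    unfolding continuous_map_componentwise
  proof (intro conjI ballI)
    show "char_action G P p ` topspace (character_topology J) \<subseteq> extensional J"
      using char_action_character[OF _ p]
      by (auto simp: topspace_character_topology characters_def PiE_def)
    show "continuous_map (character_topology J) ?D (\<lambda>\<chi>. char_action G P p \<chi> X)" if "X \<in> J" for X
      by (rule continuous_map_eq[OF coord[OF preimage_in_J[OF that p]]])
         (simp add: topspace_character_topology char_action_apply p that)
  qed
  then show ?thesis
    unfolding character_topology_def[of J]
    using char_action_character[OF _ p] topspace_character_topology[of J]
    by (auto simp: continuous_map_in_subtopology character_topology_def[symmetric])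
qed

lemma boundary_invariant:
  assumes "\<chi> \<in> boundary G P" "p \<in> P"
  shows "char_action G P p \<chi> \<in> boundary G P"
proof -
  have "char_action G P p ` boundary G P
      \<subseteq> character_topology J closure_of (char_action G P p ` maximal_characters J)"
    unfolding boundary_def
    by (rule continuous_map_image_closure_subset[OF char_action_continuous[OF assms(2)]])
  also have "\<dots> \<subseteq> boundary G P"
    unfolding boundary_def using translate_maximal[OF _ assms(2)] by (intro closure_of_mono) auto
  finally show ?thesis using assms(1) by blast
qed

lemma boundary_domain_semigroup:
  assumes "p \<in> P"
  shows "boundary_domain G P (inv p) = boundary G P"
  unfolding boundary_domain_def char_domain_def
  using acts_through_left_translation[OF _ assms] boundary_is_character assms P_subset
  by (auto simp: subset_iff)

lemma topspace_boundary_topology: "topspace (boundary_topology G P) = boundary G P"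
  unfolding boundary_topology_def
  using boundary_is_character by (auto simp: topspace_character_topology)

lemma boundary_open_contains_basic:
  assumes "openin (boundary_topology G P) V" "V \<noteq> {}"
  obtains X where "X \<in> J" "X \<noteq> {}" "\<And>\<psi>. \<psi> \<in> boundary G P \<Longrightarrow> \<psi> X = 1 \<Longrightarrow> \<psi> \<in> V"
proof -
  obtain S where S: "openin (character_topology J) S" "V = S \<inter> boundary G P"
    using assms(1) by (auto simp: boundary_topology_def openin_subtopology)
  then obtain \<chi> where \<chi>: "\<chi> \<in> S" "\<chi> \<in> maximal_characters J"
    using assms(2) openin_Int_closure_of_eq_empty[OF S(1), of "maximal_characters J"]
    by (auto simp: boundary_def)
  obtain X where X: "X \<in> J" "\<chi> X = 1" "\<And>\<psi>. \<psi> \<in> characters J \<Longrightarrow> \<psi> X = 1 \<Longrightarrow> \<psi> \<in> S"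
    using maximal_character_neighbourhood[OF Int_closed_J \<chi>(2) S(1) \<chi>(1)] by blast
  have "X \<noteq> {}"
    by (rule character_ideal_nonempty[OF maximal_character_is_character[OF \<chi>(2)] X(1,2)])
  then show ?thesis
    using that X S(2) boundary_is_character by blast
qed


section \<open>Paradoxical decompositions\<close>

lemma CO_paradoxical_of_disjoint_ideals:
  assumes pq: "p \<in> P" "q \<in> P" "(p <# P) \<inter> (q <# P) = {}"
    and V: "openin (boundary_topology G P) V" "compactin (boundary_topology G P) V" "V \<noteq> {}"
  shows "CO_paradoxical G (boundary_topology G P) (boundary_domain G P) (char_action G P) V"
proof -
  obtain X where X: "X \<in> J" "X \<noteq> {}" and XV: "\<And>\<psi>. \<psi> \<in> boundary G P \<Longrightarrow> \<psi> X = 1 \<Longrightarrow> \<psi> \<in> V"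
    using boundary_open_contains_basic[OF V(1,3)] by blast
  then obtain x where x: "x \<in> X" by blast
  have xP: "x \<in> P" using x J_subset_P[OF X(1)] by blast
  have V_sub: "V \<subseteq> boundary G P"
    using openin_subset[OF V(1)] by (simp add: topspace_boundary_topology)
  define t where "t i = x \<otimes> (if i = (1 :: nat) then p else q)" for i
  have tP: "t i \<in> P" for i using P_closed xP pq by (simp add: t_def)
  have carr: "a \<in> carrier G" if "a \<in> P" for a using that P_subset by blast
  have tX: "t i <# P \<subseteq> X" for i
    using J_right_ideal[OF X(1) J_right_ideal[OF X(1) x]] pq by (auto simp: t_def l_coset_def)
  have disj: "(t 1 <# P) \<inter> (t 2 <# P) = {}"
  proof (rule ccontr)
    assume "\<not> ?thesis"
    then obtain a b where ab: "a \<in> P" "b \<in> P" "(x \<otimes> p) \<otimes> a = (x \<otimes> q) \<otimes> b"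
      by (auto simp: l_coset_def t_def)
    then have "x \<otimes> (p \<otimes> a) = x \<otimes> (q \<otimes> b)" using xP pq by (simp add: m_assoc carr)
    then have "p \<otimes> a = q \<otimes> b" using xP pq ab by (simp add: carr)
    then show False using pq(3) ab by (auto simp: l_coset_def)
  qed
  have dom: "V \<subseteq> boundary_domain G P (inv (t i))" for i
    using V_sub boundary_domain_semigroup[OF tP] by simp
  have into: "char_action G P (t i) ` V \<subseteq> V" for i
    using V_sub boundary_is_character boundary_invariant[OF _ tP]
      char_action_contains_principal[OF _ tP X(1) tX] XV by blast
  have images: "char_action G P (t 1) ` V \<inter> char_action G P (t 2) ` V = {}"
  proof (rule ccontr)
    assume "\<not> ?thesis"
    then obtain \<chi> \<chi>' where \<chi>: "\<chi> \<in> V" "\<chi>' \<in> V"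
      and eq: "char_action G P (t 1) \<chi> = char_action G P (t 2) \<chi>'" by blast
    let ?\<psi> = "char_action G P (t 1) \<chi>"
    have c: "\<chi> \<in> characters J" "\<chi>' \<in> characters J" using \<chi> V_sub boundary_is_character by blast+
    note J1 = principal_in_J[OF tP[of 1]] and J2 = principal_in_J[OF tP[of 2]]
    have "?\<psi> (t 1 <# P) = 1"
      by (rule char_action_contains_principal[OF c(1) tP J1]) simp
    moreover have "?\<psi> (t 2 <# P) = 1"
      unfolding eq by (rule char_action_contains_principal[OF c(2) tP J2]) simp
    moreover have \<psi>: "?\<psi> \<in> characters J" by (rule char_action_character[OF c(1) tP])
    ultimately have "?\<psi> ((t 1 <# P) \<inter> (t 2 <# P)) = 1"
      using character_Int[OF \<psi> J1 J2] by simp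
    then show False
      using character_ideal_nonempty[OF \<psi> J_Int[OF J1 J2]] disj by blast
  qed
  have "{1..1 + 1} = {1, 2 :: nat}" "{1 + 1..1 + 1} = {2 :: nat}" by auto
  then show ?thesis
    unfolding CO_paradoxical_def
    using V dom into images tP carr
    by (intro exI[of _ 1] exI[of _ "\<lambda>_. V"] exI[of _ t]) (simp add: Int_commute)
qed

end

lemma not_CO_paradoxical_singleton: "\<not> CO_paradoxical G T U act {x}"
proof
  assume "CO_paradoxical G T U act {x}"
  then obtain n m :: nat and W t where
    un: "(\<Union>i\<in>{1..n}. W i) = {x}" "(\<Union>i\<in>{n+1..n+m}. W i) = {x}"
    and im: "\<forall>i\<in>{1..n+m}. act (t i) ` W i \<subseteq> {x}"
    and disj: "\<forall>i\<in>{1..n+m}. \<forall>j\<in>{1..n+m}. i \<noteq> j \<longrightarrow> act (t i) ` W i \<inter> act (t j) ` W j = {}"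
    unfolding CO_paradoxical_def by metis
  from un(1) obtain i where i: "i \<in> {1..n}" "x \<in> W i" by blast
  from un(2) obtain j where j: "j \<in> {n+1..n+m}" "x \<in> W j" by blast
  have ij: "i \<in> {1..n+m}" "j \<in> {1..n+m}" "i \<noteq> j" using i j by auto
  have "act (t i) x = x" "act (t j) x = x" using im ij i j by blast+
  then have "x \<in> act (t i) ` W i \<inter> act (t j) ` W j" using i(2) j(2) by (metis IntI imageI)
  with disj ij show False by blast
qed

theorem theorem7p16:
  fixes G :: "('a, 'b) monoid_scheme" and P :: "'a set"
  assumes "group G" and "countable (carrier G)"
    and "P \<subseteq> carrier G" and "P \<noteq> {}"
    and "\<And>p q. p \<in> P \<Longrightarrow> q \<in> P \<Longrightarrow> p \<otimes>\<^bsub>G\<^esub> q \<in> P"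
  shows "purely_infinite_transformation_groupoid G
           (boundary_topology G P) (boundary_domain G P) (char_action G P)
         \<longleftrightarrow> (\<exists>p\<in>P. \<exists>q\<in>P. (p <#\<^bsub>G\<^esub> P) \<inter> (q <#\<^bsub>G\<^esub> P) = {})"
proof -
  interpret group_subsemigroup G P
    using assms by (simp add: group_subsemigroup_def group_subsemigroup_axioms_def)
  show ?thesis
  proof
    assume pi: "purely_infinite_transformation_groupoid G
      (boundary_topology G P) (boundary_domain G P) (char_action G P)"
    show "\<exists>p\<in>P. \<exists>q\<in>P. (p <#\<^bsub>G\<^esub> P) \<inter> (q <#\<^bsub>G\<^esub> P) = {}"
    proof (rule ccontr)
      assume "\<not> ?thesis"
      then have "{} \<notin> J" by (intro empty_notin_J) blast
      then have point: "boundary G P = {restrict (\<lambda>_. 1) J}" by (rule boundary_eq_singleton)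
      have "openin (boundary_topology G P) (boundary G P)"
        using openin_topspace[of "boundary_topology G P"] by (simp add: topspace_boundary_topology)
      moreover have "compactin (boundary_topology G P) (boundary G P)"
        by (rule finite_imp_compactin) (simp_all add: topspace_boundary_topology point)
      ultimately have "CO_paradoxical G (boundary_topology G P) (boundary_domain G P)
          (char_action G P) (boundary G P)"
        using pi point by (simp add: purely_infinite_transformation_groupoid_def)
      then show False unfolding point by (rule notE[OF not_CO_paradoxical_singleton])
    qed
  next
    assume "\<exists>p\<in>P. \<exists>q\<in>P. (p <#\<^bsub>G\<^esub> P) \<inter> (q <#\<^bsub>G\<^esub> P) = {}"
    then show "purely_infinite_transformation_groupoid G
      (boundary_topology G P) (boundary_domain G P) (char_action G P)"
      unfolding purely_infinite_transformation_groupoid_def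
      using CO_paradoxical_of_disjoint_ideals by blast
  qed
qed

end
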